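(* Let $n=2^s\geq 4$ and let $(a_0,a_1,\ldots,a_{n-1})\in\mathbb{F}_2^n$. There exists a normal element of $\mathbb{F}_{2^n}$ over $\mathbb{F}_2$ whose corresponding vector is $(a_0,a_1,\ldots,a_{n-1})$ if and only if all of the following hold: 1) $a_0=1$ and $a_{n/2}=0$; 2) $a_i=a_{n-i}$ for all $1\leq i\leq n/2-1$; 3) $\sum_{1\leq i\leq n/2-1,\ i\text{ odd}} a_i=1$ in $\mathbb{F}_2$.
   Context: An element $\alpha\in\mathbb{F}_{2^n}$ is a normal element of $\mathbb{F}_{2^n}$ over $\mathbb{F}_2$ if $\{\alpha,\alpha^2,\alpha^{2^2},\ldots,\alpha^{2^{n-1}}\}$ is a basis of $\mathbb{F}_{2^n}$ over $\mathbb{F}_2$. The trace function is $\mathrm{Tr}_{2^n|2}(x)=\sum_{i=0}^{n-1}x^{2^i}$. The corresponding vector of $\alpha\in\mathbb{F}_{2^n}$ is $(a_0,\ldots,a_{n-1})\in\mathbb{F}_2^n$ with $a_i=\mathrm{Tr}_{2^n|2}(\alpha\cdot\alpha^{2^i})$ for $0\leq i\leq n-1$. *)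

theory Defs
  imports "HOL-Library.Z2" "HOL-Library.Cardinality" "HOL-Number_Theory.Number_Theory"
begin

text \<open>
  The field with two elements is the type \<^typ>\<open>bit\<close>. The field with $2^n$ elements is any type
  of class \<^class>\<open>field\<close> with $2^n$ elements; its prime field is the image of
  \<^const>\<open>of_bit\<close>, which is a field homomorphism because the characteristic is 2.
\<close>

definition scale2 :: "bit \<Rightarrow> 'a::field \<Rightarrow> 'a"
  where "scale2 c x = of_bit c * x"

lemma two_eq_zero:
  assumes "CARD('a::{field,finite}) = 2 ^ n"
  shows "(2::'a) = 0"
proof -
  have "prime CHAR('a)"
    using prime_CHAR_semidom[where ?'a = 'a] finite_imp_CHAR_pos[where ?'a = 'a] by simp
  moreover have "CHAR('a) dvd 2 ^ n"
    using CHAR_dvd_CARD[where ?'a = 'a] assms by simp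
  ultimately have "CHAR('a) = 2"
    by (metis prime_dvd_power primes_dvd_imp_eq two_is_prime_nat)
  thus ?thesis
    by (metis of_nat_CHAR of_nat_numeral)
qed

lemma vector_space_scale2:
  assumes "CARD('a::{field,finite}) = 2 ^ n"
  shows "vector_space (scale2 :: bit \<Rightarrow> 'a \<Rightarrow> 'a)"
proof
  fix a b :: bit and x :: 'a
  have "x + x = 0"
    using two_eq_zero[OF assms] by (metis mult_2 mult_zero_left)
  thus "scale2 (a + b) x = scale2 a x + scale2 b x"
    by (cases a; cases b) (auto simp: scale2_def)
  fix y :: 'a
  show "scale2 a (x + y) = scale2 a x + scale2 a y"
    by (simp add: scale2_def algebra_simps)
  show "scale2 a (scale2 b x) = scale2 (a * b) x" 
    by (cases a; cases b) (auto simp: scale2_def)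
  show "scale2 1 x = x"
    by (simp add: scale2_def)
qed

definition is_basis2 :: "'a::field set \<Rightarrow> bool"
  where "is_basis2 B \<longleftrightarrow> \<not> module.dependent scale2 B \<and> module.span scale2 B = UNIV"

definition normal_element :: "nat \<Rightarrow> 'a::field \<Rightarrow> bool"
  where "normal_element n \<alpha> \<longleftrightarrow> is_basis2 ((\<lambda>i. \<alpha> ^ (2 ^ i)) ` {..<n})"

definition trace2 :: "nat \<Rightarrow> 'a::field \<Rightarrow> 'a"
  where "trace2 n x = (\<Sum>i<n. x ^ (2 ^ i))"

text \<open>
  \<^const>\<open>trace2\<close> takes its values in the field itself; they lie in the prime field by the lemma
  below. Vectors of length $n$ over the field with two elements are functions
  \<^typ>\<open>nat \<Rightarrow> bit\<close> of which only the values at $0,\ldots,n-1$ are used.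
\<close>

definition corresponding_vector :: "nat \<Rightarrow> 'a::field \<Rightarrow> (nat \<Rightarrow> bit) \<Rightarrow> bool"
  where "corresponding_vector n \<alpha> a \<longleftrightarrow> (\<forall>i<n. of_bit (a i) = trace2 n (\<alpha> * \<alpha> ^ (2 ^ i)))"

lemma trace2_in_prime_field:
  fixes x :: "'a::{field,finite}"
  assumes card: "CARD('a) = 2 ^ n"
  shows "\<exists>!b. of_bit b = trace2 n x"
proof -
  have sq: "(u + v)\<^sup>2 = u\<^sup>2 + v\<^sup>2" for u v :: 'a
    using two_eq_zero[OF card] by (simp add: power2_sum)
  have "(\<Sum>i\<in>A. f i)\<^sup>2 = (\<Sum>i\<in>A. (f i)\<^sup>2)" if "finite A" for f :: "nat \<Rightarrow> 'a" and A
    using that by induction (simp_all add: sq)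
  hence "(trace2 n x)\<^sup>2 = (\<Sum>i<n. x ^ (2 ^ Suc i))"
    by (simp add: trace2_def mult.commute flip: power_mult)
  hence eq: "(trace2 n x)\<^sup>2 + x = trace2 n x + x ^ (2 ^ n)"
    unfolding trace2_def
    using sum.lessThan_Suc_shift[of "\<lambda>i. x ^ (2 ^ i)" n] sum.lessThan_Suc[of "\<lambda>i. x ^ (2 ^ i)" n]
    by (simp add: add.commute)
  have pw: "x ^ (2 ^ n) = x"
  proof (cases "x = 0")
    case False
    have "(\<Prod>y\<in>-{0}. x * y) = (\<Prod>y\<in>-{0}. y)"
      by (rule prod.reindex_bij_witness[of _ "\<lambda>y. y / x" "\<lambda>y. x * y"]) (use False in auto)
    hence "x ^ card (-{0::'a}) = 1"
      by (simp add: prod.distrib)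
    moreover have "Suc (card (-{0::'a})) = 2 ^ n"
      using card by (simp add: Compl_eq_Diff_UNIV card_Diff_singleton)
    ultimately show ?thesis
      by (metis mult.right_neutral power_Suc)
  qed simp
  from eq pw have "trace2 n x * (trace2 n x - 1) = 0"
    by (simp add: power2_eq_square algebra_simps)
  hence "trace2 n x = of_bit 0 \<or> trace2 n x = of_bit 1"
    by auto
  moreover have "b = c" if "of_bit b = (of_bit c :: 'a)" for b c
    using that by (cases b; cases c) auto
  ultimately show ?thesis
    by metis
qed

end

theory Submission
  imports Defs "HOL-Computational_Algebra.Polynomial"
begin

text \<open>
  Let \<open>\<sigma>\<close> be the Frobenius automorphism. Since \<open>n\<close> is a power of 2, \<open>1 + \<sigma>\<close> is nilpotent, and hence
  \<open>\<alpha>\<close> is normal iff its trace is 1. Extend the corresponding vector of \<open>\<alpha>\<close> to an even \<open>n\<close>-periodic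
  sequence \<open>f\<close> on the integers and let \<open>(Z f) i = f (i + 1) + f (i - 1)\<close>, so that \<open>Z ^ (n/2) f = 0\<close>.
  Replacing \<open>\<alpha>\<close> by \<open>\<alpha> + (1 + \<sigma>) (\<sigma> + \<sigma>\<^sup>-\<^sup>1)^(k - 1) \<alpha>\<close> with \<open>k \<ge> 2\<close> preserves the trace and
  replaces \<open>f\<close> by \<open>f + Z^k f + Z^(2 k - 1) f\<close>. If \<open>t\<close> is a sequence satisfying the three conditions, then
  \<open>Z ^ (n/2 - 2) (f + t) = 0\<close> for every normal \<open>\<alpha>\<close>. If \<open>Z ^ (n/2 - k) (f + t) = 0\<close>, then
  \<open>Z ^ (n/2 - k - 1) (f + t)\<close> is zero or the indicator of the odd integers, which is \<open>Z ^ (n/2 - 1) f\<close>; in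
  the latter case the replacement makes it zero. Increasing \<open>k\<close> up to \<open>n/2\<close> gives \<open>f = t\<close>.
\<close>

section \<open>Even periodic sequences over the field with two elements\<close>

text \<open>These rules would rewrite the field operations of \<^typ>\<open>bit\<close> to bit operations.\<close>

declare add_bit_eq_xor [simp del] mult_bit_eq_and [simp del]

lemma bit_add_self [simp]: "(a::bit) + a = 0"
  by (cases a) simp_all

text \<open>Multiplication by the Laurent polynomial \<open>T^a + T^b\<close> over the field with
  two elements, where \<open>T\<close> shifts a sequence by one. The operator \<open>Z\<close> is
  \<open>shift_sum 1 (-1)\<close>.\<close>

definition shift_sum :: "int \<Rightarrow> int \<Rightarrow> (int \<Rightarrow> bit) \<Rightarrow> int \<Rightarrow> bit"
  where "shift_sum a b f i = f (i + a) + f (i + b)"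

text \<open>Squaring in characteristic 2: the two mixed terms \<open>f (i + a + b)\<close>
  cancel.\<close>

lemma shift_sum_twice: "shift_sum a b (shift_sum a b f) = shift_sum (2 * a) (2 * b) f"
proof
  fix i
  have "i + a + b = i + b + a" "i + 2 * a = i + a + a" "i + 2 * b = i + b + b" by simp_all
  thus "shift_sum a b (shift_sum a b f) i = shift_sum (2 * a) (2 * b) f i"
    unfolding shift_sum_def by (simp add: add.commute add.left_commute)
qed

lemma shift_sum_double_exponent: "shift_sum a b ^^ (2 * k) = shift_sum (2 * a) (2 * b) ^^ k"
proof -
  have "shift_sum a b ^^ (2 * k) = (shift_sum a b ^^ 2) ^^ k"
    by (simp only: funpow_mult)
  also have "shift_sum a b ^^ 2 = shift_sum (2 * a) (2 * b)"
    by (auto simp: fun_eq_iff numeral_2_eq_2 shift_sum_twice)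
  finally show ?thesis .
qed

lemma shift_sum_power_of_2: "shift_sum a b ^^ (2 ^ r) = shift_sum (2 ^ r * a) (2 ^ r * b)"
proof (induction r arbitrary: a b)
  case (Suc r)
  show ?case
    by (simp add: shift_sum_double_exponent Suc.IH mult.assoc mult.left_commute)
qed simp

lemma shift_sum_funpow_Suc:
  "(shift_sum a b ^^ Suc k) f i = (shift_sum a b ^^ k) f (i + a) + (shift_sum a b ^^ k) f (i + b)"
  by (simp add: shift_sum_def[of _ _ "(shift_sum a b ^^ k) f"])

lemma shift_sum_funpow_add:
  "(shift_sum a b ^^ k) (\<lambda>i. f i + g i) i = (shift_sum a b ^^ k) f i + (shift_sum a b ^^ k) g i"
proof (induction k arbitrary: i)
  case (Suc k)
  thus ?case by (simp add: shift_sum_def ac_simps)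
qed simp

lemma shift_sum_funpow_zero: "(shift_sum a b ^^ k) (\<lambda>i. 0) = (\<lambda>i. 0)"
  by (induction k) (simp_all add: shift_sum_def fun_eq_iff)

lemma shift_sum_funpow_even:
  assumes "\<And>i. f (- i) = f i"
  shows "(shift_sum 1 (-1) ^^ k) f (- i) = (shift_sum 1 (-1) ^^ k) f i"
proof (induction k arbitrary: i)
  case (Suc k)
  have "(shift_sum 1 (-1) ^^ Suc k) f (- i) =
      (shift_sum 1 (-1) ^^ k) f (- (i - 1)) + (shift_sum 1 (-1) ^^ k) f (- (i + 1))"
    unfolding shift_sum_funpow_Suc by simp
  thus ?case unfolding Suc.IH shift_sum_funpow_Suc by (simp add: add.commute)
qed (simp add: assms)

text \<open>The last application adds the values at 1 and -1, which agree because the operator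
  preserves evenness.\<close>

lemma shift_sum_funpow_even_0:
  assumes "\<And>i. f (- i) = f i" "k > 0"
  shows "(shift_sum 1 (-1) ^^ k) f 0 = 0"
proof -
  from \<open>k > 0\<close> obtain j where "k = Suc j" by (cases k) auto
  thus ?thesis
    using shift_sum_funpow_even[of f j 1, OF assms(1)] by (simp add: shift_sum_def)
qed

lemma sum_lessThan_add:
  fixes g :: "nat \<Rightarrow> 'b::comm_monoid_add"
  shows "(\<Sum>j<a + b. g j) = (\<Sum>j<a. g j) + (\<Sum>j<b. g (j + a))"
  by (induction b) (simp_all add: ac_simps)

text \<open>All binomial coefficients of \<open>2 ^ r - 1\<close> are odd, so every term of
  \<open>(T^d + T^(-d)) ^ (2 ^ r - 1)\<close> survives. The induction splits off the power
  \<open>2 ^ r\<close>, which is again a sum of two shifts.\<close>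

lemma shift_sum_funpow_pred_power_of_2:
  "(shift_sum d (-d) ^^ (2 ^ r - 1)) f i = (\<Sum>j<2 ^ r. f (i + d * (2 * int j + 1 - 2 ^ r)))"
proof (induction r arbitrary: i)
  case (Suc r)
  let ?h = "\<lambda>j::nat. f (i + d * (2 * int j + 1 - 2 ^ Suc r))"
  have "(2::nat) ^ Suc r - 1 = 2 ^ r + (2 ^ r - 1)" by simp
  hence "(shift_sum d (-d) ^^ (2 ^ Suc r - 1)) f i =
      (shift_sum d (-d) ^^ (2 ^ r - 1)) f (i + 2 ^ r * d)
    + (shift_sum d (-d) ^^ (2 ^ r - 1)) f (i - 2 ^ r * d)"
    by (simp only: funpow_add o_apply shift_sum_power_of_2) (simp add: shift_sum_def)
  also have "\<dots> = (\<Sum>j<2 ^ r. ?h (j + 2 ^ r)) + (\<Sum>j<2 ^ r. ?h j)"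
  proof -
    have "i + D * d + d * (2 * J + 1 - D) = i + d * (2 * (J + D) + 1 - 2 * D)"
      "i - D * d + d * (2 * J + 1 - D) = i + d * (2 * J + 1 - 2 * D)" for D J :: int
      by (simp_all add: algebra_simps)
    from arg_cong[of _ _ f, OF this(1), of "2 ^ r"] arg_cong[of _ _ f, OF this(2), of "2 ^ r"]
    show ?thesis unfolding Suc by (intro arg_cong2[of _ _ _ _ plus] sum.cong refl) simp_all
  qed
  also have "\<dots> = (\<Sum>j<2 ^ Suc r. ?h j)"
  proof -
    have "(2::nat) ^ Suc r = 2 ^ r + 2 ^ r" by simp
    thus ?thesis by (simp only: sum_lessThan_add add.commute)
  qed
  finally show ?case .
qed simp

lemma shift_sum_zero_parity:
  assumes "shift_sum 1 (-1) f = (\<lambda>i. 0)"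
  shows "f i = f (i mod 2)"
proof -
  have step: "f (i + 2) = f i" for i
  proof -
    have "shift_sum 1 (-1) f (i + 1) = 0" using assms by simp
    hence "f (i + 2) + f i = 0" by (simp add: shift_sum_def add.commute)
    thus ?thesis by (cases "f (i + 2)"; cases "f i") auto
  qed
  have "f (k + 2 * j) = f k" for j k
  proof (induction j rule: int_induct[of _ 0])
    case (step1 j)
    thus ?case using step[of "k + 2 * j"] by (simp add: algebra_simps)
  next
    case (step2 j)
    thus ?case using step[of "k + 2 * (j - 1)"] by (simp add: algebra_simps)
  qed simp
  from this[of "i mod 2" "i div 2"] show ?thesis by simp
qed

text \<open>The terms at \<open>j\<close> and \<open>2 * h - j\<close> cancel; only
  \<open>0\<close>, whose partner is out of range, and the fixed point \<open>h\<close>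
  remain.\<close>

lemma sum_symmetric_bit:
  fixes g :: "nat \<Rightarrow> bit"
  assumes "\<And>j. 0 < j \<Longrightarrow> j < h \<Longrightarrow> g (2 * h - j) = g j" "h > 0"
  shows "(\<Sum>j<2 * h. g j) = g 0 + g h"
proof -
  have "{..<2 * h} = insert 0 (insert h ({1..<h} \<union> {h + 1..<2 * h}))"
    using \<open>h > 0\<close> by auto
  moreover have "(\<Sum>j\<in>{h + 1..<2 * h}. g j) = (\<Sum>j\<in>{1..<h}. g j)"
    by (rule sum.reindex_bij_witness[of _ "\<lambda>j. 2 * h - j" "\<lambda>j. 2 * h - j"])
      (use assms(1) in \<open>auto simp: assms(1)[symmetric]\<close>)
  ultimately show ?thesis
    using \<open>h > 0\<close> by (simp add: sum.union_disjoint)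
qed

text \<open>Each pair \<open>{i, 4 * q - i}\<close> of odd indices has exactly one member below
  \<open>2 * q\<close> and exactly one congruent to 1 modulo 4, so both sides pick one
  representative per pair. This brings condition 3 into a form that traces can evaluate.\<close>

lemma sum_odd_eq_sum_1_mod_4:
  fixes g :: "nat \<Rightarrow> 'b::comm_monoid_add"
  assumes "\<And>i. 0 < i \<Longrightarrow> i < 2 * q \<Longrightarrow> g (4 * q - i) = g i"
  shows "(\<Sum>i | 1 \<le> i \<and> i \<le> 2 * q - 1 \<and> odd i. g i) = (\<Sum>j<q. g (4 * j + 1))"
proof -
  \<comment> \<open>\<open>fold\<close> passes to the member of the pair below \<open>2 * q\<close>;
    \<open>unfold i\<close> is the \<open>j\<close> such that \<open>4 * j + 1\<close> is the member
    congruent to 1 modulo 4.\<close>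
  define fold where "fold k = (if k < 2 * q then k else 4 * q - k)" for k
  define unfold where "unfold i = (if i mod 4 = 1 then i else 4 * q - i) div 4" for i
  have unfold: "4 * unfold i + 1 = (if i mod 4 = 1 then i else 4 * q - i)" "unfold i < q"
    if "1 \<le> i" "i \<le> 2 * q - 1" "odd i" for i
  proof -
    have "i = 4 * (i div 4) + 1 \<or> i = 4 * (i div 4) + 3"
      using \<open>odd i\<close> by presburger
    then obtain k where "i = 4 * k + 1 \<or> i = 4 * k + 3" by blast
    moreover from this have "k < q" using that by auto
    moreover have "4 * q - (4 * k + 3) = 4 * (q - k - 1) + 1"
      using \<open>k < q\<close> by simp
    ultimately show "4 * unfold i + 1 = (if i mod 4 = 1 then i else 4 * q - i)" "unfold i < q"
      unfolding unfold_def by auto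
  qed
  have fold: "1 \<le> fold (4 * j + 1)" "fold (4 * j + 1) \<le> 2 * q - 1" "odd (fold (4 * j + 1))"
    "unfold (fold (4 * j + 1)) = j" if "j < q" for j
  proof -
    have *: "4 * q - (4 * j + 1) = 4 * (q - j - 1) + 3"
      using that by simp
    hence "(4 * q - (4 * j + 1)) mod 4 = 3" "odd (4 * q - (4 * j + 1))"
      by simp_all
    moreover have "4 * q - (4 * j + 1) \<le> 2 * q - 1" if "\<not> 4 * j + 1 < 2 * q"
      using that by presburger
    ultimately show "1 \<le> fold (4 * j + 1)" "fold (4 * j + 1) \<le> 2 * q - 1" "odd (fold (4 * j + 1))"
      "unfold (fold (4 * j + 1)) = j"
      using that * unfolding unfold_def fold_def by auto
  qed
  show ?thesis
  proof (rule sum.reindex_bij_witness[of _ "\<lambda>j. fold (4 * j + 1)" unfold])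
    fix i assume "i \<in> {i. 1 \<le> i \<and> i \<le> 2 * q - 1 \<and> odd i}"
    hence i: "1 \<le> i" "i \<le> 2 * q - 1" "odd i" by auto
    show "unfold i \<in> {..<q}" using unfold(2)[OF i] by simp
    show "fold (4 * unfold i + 1) = i"
      unfolding unfold(1)[OF i] fold_def using i by auto
    show "g (4 * unfold i + 1) = g i"
      unfolding unfold(1)[OF i] using i assms[of i] by auto
  qed (use fold in auto)
qed

lemma sum_lessThan_4_mult:
  fixes g :: "nat \<Rightarrow> 'b::comm_monoid_add"
  shows "(\<Sum>l<4 * q. g l) =
    (\<Sum>j<q. g (4 * j) + g (4 * j + 1) + g (4 * j + 2) + g (4 * j + 3))"
proof (induction q)
  case (Suc q)
  have "4 * Suc q = Suc (Suc (Suc (Suc (4 * q))))" by simp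
  thus ?case using Suc by (simp add: ac_simps numeral_eq_Suc)
qed simp

lemma sum_periodic_shift:
  fixes g :: "int \<Rightarrow> 'b::ab_group_add"
  assumes "g (int n) = g 0"
  shows "(\<Sum>l<n. g (int l + 1)) = (\<Sum>l<n. g (int l))"
  using sum.lessThan_Suc_shift[of "\<lambda>l. g (int l)" n] sum.lessThan_Suc[of "\<lambda>l. g (int l)" n] assms
  by (simp add: add.commute)


section \<open>High powers of \<open>Z\<close> on even periodic sequences\<close>

locale even_periodic =
  fixes r :: nat and f :: "int \<Rightarrow> bit"
  assumes even: "f (- i) = f i" and periodic: "f (i + 2 ^ (r + 2)) = f i"
begin

text \<open>A power of 2 as exponent leaves the sum of the shifts by half a period in both
  directions, which differ by a full period.\<close>

lemma funpow_half_period: "(shift_sum 1 (-1) ^^ 2 ^ (r + 1)) f = (\<lambda>i. 0)"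
proof
  fix i
  have "i - 2 ^ (r + 1) + 2 ^ (r + 2) = i + (2 ^ (r + 1) :: int)" by simp
  with periodic[of "i - 2 ^ (r + 1)"] have "f (i + 2 ^ (r + 1)) = f (i - 2 ^ (r + 1))"
    by metis
  thus "(shift_sum 1 (-1) ^^ 2 ^ (r + 1)) f i = 0"
    unfolding shift_sum_power_of_2 by (simp add: shift_sum_def)
qed

text \<open>One more application gives zero, so only the parity of \<open>i\<close> matters.
  Evenness settles the value at 0; the value at 1 is the sum of the even-indexed terms of one
  period, of which symmetry leaves two.\<close>

lemma funpow_half_period_minus_1:
  "(shift_sum 1 (-1) ^^ (2 ^ (r + 1) - 1)) f i = (if odd i then f 0 + f (2 ^ (r + 1)) else 0)"
proof -
  let ?d = "(shift_sum 1 (-1) ^^ (2 ^ (r + 1) - 1)) f"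
  have "shift_sum 1 (-1) ?d = (shift_sum 1 (-1) ^^ Suc (2 ^ (r + 1) - 1)) f"
    by (simp only: funpow.simps o_apply)
  also have "Suc (2 ^ (r + 1) - 1) = 2 ^ (r + 1)" by simp
  also note funpow_half_period
  finally have parity: "?d i = ?d (i mod 2)" for i
    by (rule shift_sum_zero_parity)
  have "(2::nat) ^ (r + 1) - 1 > 0"
    using one_less_power[of "2::nat" "r + 1"] by linarith
  hence 0: "?d 0 = 0"
    by (intro shift_sum_funpow_even_0 even)
  \<comment> \<open>The value at 1 is read off at another odd place, where the indices of the sum
    become \<open>2 * j\<close>.\<close>
  have "?d 1 = ?d (2 ^ (r + 1) - 1)"
    using parity[of "2 ^ (r + 1) - 1"] by (simp add: mod_diff_eq[symmetric])
  also have "\<dots> = (\<Sum>j<2 ^ (r + 1). f (2 * int j))"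
    unfolding shift_sum_funpow_pred_power_of_2 by simp
  also have "\<dots> = (\<Sum>j<2 * 2 ^ r. f (2 * int j))"
    by simp
  also have "\<dots> = f (2 * int 0) + f (2 * int (2 ^ r))"
  proof (rule sum_symmetric_bit)
    fix j :: nat assume "j < 2 ^ r"
    hence "2 * int (2 * 2 ^ r - j) = - (2 * int j) + 2 ^ (r + 2)"
      by (simp add: of_nat_diff)
    thus "f (2 * int (2 * 2 ^ r - j)) = f (2 * int j)"
      by (simp only: periodic even)
  qed simp
  finally have 1: "?d 1 = f 0 + f (2 ^ (r + 1))" by simp
  show ?thesis
    using parity[of i] 0 1 by (cases "odd i")
      (simp_all add: odd_iff_mod_2_eq_one even_iff_mod_2_eq_zero)
qed

text \<open>The assumptions make the next iterate vanish, so again only the parity of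
  \<open>i\<close> matters.\<close>

lemma funpow_half_period_minus_2:
  assumes "f 0 = 0" "f (2 ^ (r + 1)) = 0"
  shows "(shift_sum 1 (-1) ^^ (2 ^ (r + 1) - 2)) f i =
    (if odd i then \<Sum>j<2 ^ r. f (4 * int j + 1) else 0)"
proof -
  let ?d = "(shift_sum 1 (-1) ^^ (2 ^ (r + 1) - 2)) f"
  have "Suc (2 ^ (r + 1) - 2) = (2::nat) ^ (r + 1) - 1"
    using one_less_power[of "2::nat" "r + 1"] by linarith
  moreover have "shift_sum 1 (-1) ?d = (shift_sum 1 (-1) ^^ Suc (2 ^ (r + 1) - 2)) f"
    by simp
  ultimately have "shift_sum 1 (-1) ?d = (\<lambda>i. 0)"
    using funpow_half_period_minus_1 assms by (simp only:) (simp add: fun_eq_iff)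
  hence parity: "?d i = ?d (i mod 2)" for i
    by (rule shift_sum_zero_parity)
  have 0: "?d 0 = 0"
  \<comment> \<open>For \<open>r = 0\<close> the exponent is 0 and the value is \<open>f 0\<close>
    itself.\<close>
  proof (cases "2 ^ (r + 1) - 2 = (0::nat)")
    case False
    thus ?thesis by (intro shift_sum_funpow_even_0 even) simp
  qed (simp only: funpow_0 assms)
  have "?d 1 = ?d (2 ^ (r + 1) - 1)"
    using parity[of "2 ^ (r + 1) - 1"] by (simp add: mod_diff_eq[symmetric])
  \<comment> \<open>Since the exponent is twice \<open>2 ^ r - 1\<close>, the operator can be
    squared first. The resulting sum has steps of 4, and its indices at this place are
    \<open>4 * j + 1\<close>.\<close>
  also have "\<dots> = (shift_sum 2 (-2) ^^ (2 ^ r - 1)) f (2 ^ (r + 1) - 1)"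
  proof -
    have "(2::nat) ^ (r + 1) - 2 = 2 * (2 ^ r - 1)" by simp
    thus ?thesis by (simp only: shift_sum_double_exponent) simp
  qed
  also have "\<dots> = (\<Sum>j<2 ^ r. f (4 * int j + 1))"
    unfolding shift_sum_funpow_pred_power_of_2 by (simp add: algebra_simps)
  finally have 1: "?d 1 = (\<Sum>j<2 ^ r. f (4 * int j + 1))" .
  show ?thesis
    using parity[of i] 0 1 by (cases "odd i")
      (simp_all add: odd_iff_mod_2_eq_one even_iff_mod_2_eq_zero)
qed

end


section \<open>Frobenius automorphism, trace and normality\<close>

locale binary_field =
  fixes n :: nat and field_type :: "'a::{field,finite} itself"
  assumes card: "CARD('a) = 2 ^ n"
begin

sublocale vs: vector_space "scale2 :: bit \<Rightarrow> 'a \<Rightarrow> 'a"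
  by (rule vector_space_scale2[OF card])

lemma add_self [simp]: "x + x = (0::'a)"
  using two_eq_zero[OF card] by (metis mult_2 mult_zero_left)

lemma of_bit_add: "(of_bit (a + b) :: 'a) = of_bit a + of_bit b"
  by (cases a; cases b) simp_all

lemma of_bit_inject [simp]: "(of_bit a :: 'a) = of_bit b \<longleftrightarrow> a = b"
  by (cases a; cases b) simp_all

lemma n_pos: "n > 0"
proof (rule ccontr)
  assume "\<not> n > 0"
  moreover have "card {0, 1::'a} \<le> CARD('a)" by (rule card_mono) auto
  ultimately show False using card by simp
qed

lemma power_card: "x ^ (2 ^ n) = (x::'a)"
proof (cases "x = 0")
  case False
  have "(\<Prod>y\<in>-{0}. x * y) = (\<Prod>y\<in>-{0}. y)"
    by (rule prod.reindex_bij_witness[of _ "\<lambda>y. y / x" "\<lambda>y. x * y"]) (use False in auto)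
  hence "x ^ card (-{0::'a}) = 1"
    by (simp add: prod.distrib)
  moreover have "Suc (card (-{0::'a})) = 2 ^ n"
    using card by (simp add: Compl_eq_Diff_UNIV card_Diff_singleton)
  ultimately show ?thesis
    by (metis mult.right_neutral power_Suc)
qed simp

lemma power_power_mod: "x ^ (2 ^ (k mod n)) = x ^ (2 ^ k)" for x :: 'a
proof -
  have "x ^ (2 ^ (n * j + i)) = x ^ (2 ^ i)" for i j
    by (induction j) (simp_all add: power_add power_mult power_card add.assoc)
  from this[of "k div n" "k mod n"] show ?thesis by simp
qed

lemma power_add_distrib: "(x + y) ^ (2 ^ k) = x ^ (2 ^ k) + y ^ (2 ^ k)" for x y :: 'a
proof (induction k)
  case (Suc k)
  have "(u + v)\<^sup>2 = u\<^sup>2 + v\<^sup>2" for u v :: 'a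
    using two_eq_zero[OF card] by (simp add: power2_sum)
  with Suc show ?case by (simp add: power_mult mult.commute[of 2])
qed simp

text \<open>Powers of the Frobenius automorphism. As its \<open>n\<close>-th power is the identity,
  reduction modulo \<open>n\<close> gives meaning to negative exponents.\<close>

definition frob :: "int \<Rightarrow> 'a \<Rightarrow> 'a"
  where "frob i x = x ^ (2 ^ nat (i mod int n))"

lemma frob_of_nat: "frob (int k) x = x ^ (2 ^ k)"
  by (simp add: frob_def power_power_mod flip: zmod_int)

lemma frob_mod: "frob (i mod int n) x = frob i x"
  by (simp add: frob_def)

lemma frob_frob: "frob i (frob j x) = frob (i + j) x"
proof -
  have "frob i (frob j x) = frob (int (nat (j mod int n) + nat (i mod int n))) x"
    by (simp only: frob_of_nat) (simp add: frob_def power_add power_mult)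
  also have "int (nat (j mod int n) + nat (i mod int n)) = j mod int n + i mod int n"
    using n_pos by simp
  also have "frob \<dots> x = frob (i + j) x"
    by (simp add: frob_def mod_simps add.commute)
  finally show ?thesis .
qed

lemma frob_0 [simp]: "frob 0 x = x"
  by (simp add: frob_def)

lemma frob_zero [simp]: "frob i 0 = 0"
  by (simp add: frob_def)

lemma frob_add: "frob i (x + y) = frob i x + frob i y"
  by (simp add: frob_def power_add_distrib)

lemma frob_mult: "frob i (x * y) = frob i x * frob i y"
  by (simp add: frob_def power_mult_distrib)

lemma frob_sum: "frob i (sum g A) = (\<Sum>x\<in>A. frob i (g x))"
  by (induction A rule: infinite_finite_induct) (simp_all add: frob_add)

lemma frob_of_bit: "frob i (of_bit b) = of_bit b"
  by (cases b) (simp_all add: frob_def)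

lemma frob_period: "frob (i + int n) x = frob i x"
  by (simp add: frob_def)

section \<open>The trace as a map onto the field with two elements\<close>

lemma trace2_eq_sum_frob: "trace2 n x = (\<Sum>l<n. frob (int l) x)"
  by (simp add: trace2_def frob_of_nat)

lemma trace2_frob: "trace2 n (frob i x) = trace2 n x"
proof -
  have step: "trace2 n (frob 1 x) = trace2 n x" for x
    using sum_periodic_shift[of "\<lambda>i. frob i x" n] frob_period[of 0 x]
    by (simp add: trace2_eq_sum_frob frob_frob)
  have "trace2 n (frob (int k) x) = trace2 n x" for k
  proof (induction k)
    case (Suc k)
    thus ?case using step[of "frob (int k) x"] by (simp add: frob_frob)
  qed simp
  from this[of "nat (i mod int n)"] show ?thesis
    using n_pos by (simp add: frob_mod)
qed

text \<open>Since \<open>trace2\<close> takes only the values 0 and 1, sending every nonzero value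
  to 1 is faithful; \<open>of_bit_tr\<close> confirms this.\<close>

definition tr :: "'a \<Rightarrow> bit"
  where "tr x = (if trace2 n x = 0 then 0 else 1)"

lemma of_bit_tr: "of_bit (tr x) = trace2 n x"
proof -
  obtain b where "of_bit b = trace2 n x"
    using trace2_in_prime_field[OF card] by blast
  thus ?thesis by (cases b) (auto simp: tr_def)
qed

lemma tr_eq_1_iff: "tr x = 1 \<longleftrightarrow> trace2 n x = 1"
  using of_bit_tr[of x] by (cases "tr x") auto

lemma trace2_add: "trace2 n (x + y) = trace2 n x + trace2 n y" for x y :: 'a
  by (simp add: trace2_eq_sum_frob frob_add sum.distrib)

lemma tr_add: "tr (x + y) = tr x + tr y"
proof -
  have "(of_bit (tr (x + y)) :: 'a) = of_bit (tr x + tr y)"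
    by (simp only: of_bit_tr of_bit_add trace2_add)
  thus ?thesis by (simp only: of_bit_inject)
qed

lemma tr_zero [simp]: "tr 0 = 0"
  by (simp add: tr_def trace2_eq_sum_frob)

lemma tr_sum: "tr (sum g A) = (\<Sum>x\<in>A. tr (g x))"
  by (induction A rule: infinite_finite_induct) (simp_all add: tr_add)

lemma tr_frob [simp]: "tr (frob i x) = tr x"
  by (simp add: tr_def trace2_frob)

text \<open>Otherwise the trace polynomial, nonzero and of degree at most
  \<open>2 ^ (n - 1)\<close>, would have all \<open>2 ^ n\<close> field elements as roots.\<close>

lemma ex_tr_eq_1: "\<exists>x. tr x = 1"
proof (rule ccontr)
  assume "\<not> (\<exists>x. tr x = 1)"
  hence 0: "trace2 n x = 0" for x :: 'a
    by (auto simp: tr_def split: if_splits)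
  define p where "p = (\<Sum>i<n. Polynomial.monom (1::'a) (2 ^ i))"
  have "Polynomial.coeff p 1 = (\<Sum>i<n. if i = 0 then 1 else 0)"
    unfolding p_def Polynomial.coeff_sum Polynomial.coeff_monom by (intro sum.cong) auto
  also have "\<dots> = 1" using n_pos by simp
  finally have "p \<noteq> 0" by auto
  have "poly p x = trace2 n x" for x
    by (simp add: p_def trace2_def poly_sum poly_monom)
  hence "2 ^ n \<le> Polynomial.degree p"
    using card_poly_roots_bound[OF \<open>p \<noteq> 0\<close>] 0 card by simp
  moreover have "Polynomial.degree p \<le> 2 ^ (n - 1)"
    unfolding p_def by (intro degree_sum_le) (auto intro!: order_trans[OF degree_monom_le])
  moreover have "(2::nat) ^ (n - 1) < 2 ^ n"
    using n_pos by (intro power_strict_increasing) auto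
  ultimately show False by linarith
qed


text \<open>Periodic relations between the conjugates are closed under \<open>?Y\<close>, whose
  \<open>n\<close>-th power kills them because \<open>n\<close> is a power of 2. A nonzero relation
  would thus lead to a nonzero one killed by \<open>?Y\<close>, which is constantly 1 and says that
  the trace is 0.\<close>

lemma frob_relation_trivial:
  fixes e :: "int \<Rightarrow> bit"
  assumes n: "n = 2 ^ s" and "tr \<alpha> = 1"
    and e: "\<And>i. e (i + int n) = e i" "(\<Sum>j<n. of_bit (e (int j)) * frob (int j) \<alpha>) = 0"
  shows "e = (\<lambda>i. 0)"
proof (rule ccontr)
  let ?Y = "shift_sum 0 (-1)"
  define relation where "relation e \<longleftrightarrow> (\<forall>i. e (i + int n) = e i) \<and>
    (\<Sum>j<n. of_bit (e (int j)) * frob (int j) \<alpha>) = 0" for e :: "int \<Rightarrow> bit"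
  have relation_step: "relation (?Y e)" if "relation e" for e
  proof -
    have per: "e (i + int n) = e i" for i
      using that by (simp add: relation_def)
    \<comment> \<open>Delaying the coefficients by one applies Frobenius to the whole
      relation.\<close>
    have "(\<Sum>j<n. of_bit (e (int j - 1)) * frob (int j) \<alpha>)
        = (\<Sum>j<n. of_bit (e (int j)) * frob (int j + 1) \<alpha>)"
      using sum_periodic_shift[of "\<lambda>i. of_bit (e (i - 1)) * frob i \<alpha>" n]
        per[of "-1"] frob_period[of 0 \<alpha>] by (simp add: add.commute)
    also have "\<dots> = frob 1 (\<Sum>j<n. of_bit (e (int j)) * frob (int j) \<alpha>)"
      by (simp only: frob_sum frob_mult frob_of_bit frob_frob add.commute)
    also have "\<dots> = 0"
      using that by (simp add: relation_def)
    finally have "(\<Sum>j<n. of_bit (?Y e (int j)) * frob (int j) \<alpha>) = 0"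
      using that
      by (simp only: shift_sum_def of_bit_add distrib_right sum.distrib relation_def) simp
    moreover have "?Y e (i + int n) = ?Y e i" for i
      using per[of i] per[of "i - 1"] by (simp add: shift_sum_def algebra_simps)
    ultimately show ?thesis by (simp add: relation_def)
  qed
  have relation_funpow: "relation ((?Y ^^ k) e)" for k
    by (induction k) (use e relation_step in \<open>auto simp: relation_def\<close>)
  assume "e \<noteq> (\<lambda>i. 0)"
  have "(?Y ^^ n) e i = 0" for i
    unfolding n shift_sum_power_of_2 using e(1)[of "i - 2 ^ s"] n by (simp add: shift_sum_def)
  hence "(?Y ^^ n) e = (\<lambda>i. 0)" by blast
  then obtain k where k: "(?Y ^^ k) e = (\<lambda>i. 0)" "\<And>l. l < k \<Longrightarrow> (?Y ^^ l) e \<noteq> (\<lambda>i. 0)"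
    using exists_least_iff[of "\<lambda>k. (?Y ^^ k) e = (\<lambda>i. 0)"] by blast
  have "k \<noteq> 0" using k(1) \<open>e \<noteq> _\<close> by (intro notI) simp
  then obtain l where l: "k = Suc l" by (cases k) auto
  define d where "d = (?Y ^^ l) e"
  have d: "d \<noteq> (\<lambda>i. 0)" "?Y d = (\<lambda>i. 0)" "relation d"
    using k l relation_funpow[of l] by (simp_all add: d_def)
  have step: "d (i - 1) = d i" for i
    using fun_cong[OF d(2), of i] by (cases "d i"; cases "d (i - 1)") (simp_all add: shift_sum_def)
  have "d i = d 0" for i
  proof (induction i rule: int_induct[of _ 0])
    case (step1 i)
    thus ?case using step[of "i + 1"] by simp
  qed (simp_all add: step)
  moreover from d(1) obtain i where "d i \<noteq> 0" by blast
  ultimately have "d i = 1" for i by (metis bit_not_zero_iff)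
  hence "trace2 n \<alpha> = 0"
    using d(3) by (simp add: relation_def trace2_eq_sum_frob)
  with \<open>tr \<alpha> = 1\<close> show False by (simp add: tr_def)
qed

text \<open>Equal sums over \<open>A\<close> and \<open>B\<close> give a relation whose coefficients
  indicate the symmetric difference. Indexing by exponents, not by conjugates, makes distinctness of
  the conjugates a special case.\<close>

lemma inj_on_conjugate_sums:
  assumes n: "n = 2 ^ s" and tr: "tr \<alpha> = 1"
  shows "inj_on (\<lambda>A. \<Sum>j\<in>A. frob (int j) \<alpha>) (Pow {..<n})"
proof (rule inj_onI)
  fix A B assume AB: "A \<in> Pow {..<n}" "B \<in> Pow {..<n}"
    and eq: "(\<Sum>j\<in>A. frob (int j) \<alpha>) = (\<Sum>j\<in>B. frob (int j) \<alpha>)"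
  define e :: "int \<Rightarrow> bit"
    where "e i = of_bool (nat (i mod int n) \<in> A) + of_bool (nat (i mod int n) \<in> B)" for i
  have sum: "(\<Sum>j<n. of_bit (of_bool (j \<in> C)) * frob (int j) \<alpha>) = (\<Sum>j\<in>C. frob (int j) \<alpha>)"
    if "C \<in> Pow {..<n}" for C
    using that by (intro sum.mono_neutral_cong_right) auto
  have "(\<Sum>j<n. of_bit (e (int j)) * frob (int j) \<alpha>) =
      (\<Sum>j<n. of_bit (of_bool (j \<in> A)) * frob (int j) \<alpha>)
    + (\<Sum>j<n. of_bit (of_bool (j \<in> B)) * frob (int j) \<alpha>)"
    unfolding e_def of_bit_add distrib_right sum.distrib
    by (intro arg_cong2[of _ _ _ _ plus] sum.cong refl) simp_all
  also have "\<dots> = 0"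
    unfolding sum[OF AB(1)] sum[OF AB(2)] eq by simp
  finally have 0: "e = (\<lambda>i. 0)"
    by (intro frob_relation_trivial[OF n tr]) (simp_all add: e_def)
  have "j \<in> A \<longleftrightarrow> j \<in> B" if "j < n" for j
    using fun_cong[OF 0, of "int j"] that by (cases "j \<in> A"; cases "j \<in> B") (simp_all add: e_def)
  with AB show "A = B" by blast
qed

lemma normal_element_eq: "normal_element n \<alpha> \<longleftrightarrow> is_basis2 ((\<lambda>j. frob (int j) \<alpha>) ` {..<n})"
  by (simp add: normal_element_def frob_of_nat)

text \<open>Conjugates of an element of trace 0 stay in the kernel of \<open>tr\<close>, a proper
  subspace. For trace 1 the \<open>2 ^ n\<close> subset sums of conjugates are distinct, so they
  fill the field, and only the empty one vanishes.\<close>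

lemma normal_element_iff_tr:
  assumes n: "n = 2 ^ s"
  shows "normal_element n \<alpha> \<longleftrightarrow> tr \<alpha> = 1"
proof
  let ?B = "(\<lambda>j. frob (int j) \<alpha>) ` {..<n}"
  assume "normal_element n \<alpha>"
  hence span: "vs.span ?B = UNIV"
    by (simp add: normal_element_eq is_basis2_def)
  show "tr \<alpha> = 1"
  proof (rule ccontr)
    assume "tr \<alpha> \<noteq> 1"
    hence "?B \<subseteq> {x. tr x = 0}" by auto
    moreover have "vs.subspace {x. tr x = 0}"
    proof (rule vs.subspaceI)
      fix c x assume "x \<in> {x. tr x = 0}"
      thus "scale2 c x \<in> {x. tr x = 0}" by (cases c) (simp_all add: scale2_def)
    qed (simp_all add: tr_add)
    ultimately have "tr x = 0" for x
      using vs.span_minimal[of ?B "{x. tr x = 0}"] span by auto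
    with ex_tr_eq_1 show False by simp
  qed
next
  let ?B = "(\<lambda>j. frob (int j) \<alpha>) ` {..<n}" and ?g = "\<lambda>A. \<Sum>j\<in>A. frob (int j) \<alpha>"
  assume tr: "tr \<alpha> = 1"
  note inj = inj_on_conjugate_sums[OF n tr]
  have "card (?g ` Pow {..<n}) = CARD('a)"
    by (simp add: card_image[OF inj] card_Pow card)
  hence surj: "?g ` Pow {..<n} = UNIV"
    by (intro card_subset_eq) simp_all
  have "?g ` Pow {..<n} \<subseteq> vs.span ?B"
    by (intro image_subsetI vs.span_sum vs.span_base) auto
  hence "vs.span ?B = UNIV"
    unfolding surj by (rule top.extremum_uniqueI)
  moreover have "\<not> vs.dependent ?B"
  proof
    assume "vs.dependent ?B"
    then obtain t u v where t: "finite t" "t \<subseteq> ?B" "(\<Sum>v\<in>t. scale2 (u v) v) = 0"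
      and v: "v \<in> t" "u v \<noteq> 0"
      unfolding vs.dependent_explicit by blast
    \<comment> \<open>Over \<open>bit\<close> a linear combination is a subset sum; \<open>A\<close>
      collects the exponents with coefficient 1.\<close>
    define A where "A = {j \<in> {..<n}. frob (int j) \<alpha> \<in> t \<and> u (frob (int j) \<alpha>) = 1}"
    have inj_conj: "inj_on (\<lambda>j. frob (int j) \<alpha>) {..<n}"
    proof (rule inj_onI)
      fix j k assume "j \<in> {..<n}" "k \<in> {..<n}" "frob (int j) \<alpha> = frob (int k) \<alpha>"
      with inj_onD[OF inj, of "{j}" "{k}"] show "j = k" by simp
    qed
    have "?g A = (\<Sum>v\<in>(\<lambda>j. frob (int j) \<alpha>) ` A. v)"
      by (subst sum.reindex) (auto intro: inj_on_subset[OF inj_conj] simp: A_def)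
    also have "(\<lambda>j. frob (int j) \<alpha>) ` A = {v \<in> t. u v = 1}"
      using t(2) by (auto simp: A_def)
    also have "(\<Sum>v\<in>{v \<in> t. u v = 1}. v) = (\<Sum>v\<in>t. scale2 (u v) v)"
      using t(1) by (intro sum.mono_neutral_cong_left) (auto simp: scale2_def)
    finally have "?g A = ?g {}" using t(3) by simp
    hence "A = {}"
      by (rule inj_onD[OF inj]) (auto simp: A_def)
    moreover from v t(2) obtain j where "j < n" "v = frob (int j) \<alpha>" by auto
    ultimately show False using v by (auto simp: A_def)
  qed
  ultimately show "normal_element n \<alpha>"
    by (simp add: normal_element_eq is_basis2_def)
qed

end

section \<open>Corresponding vectors\<close>

context binary_field
begin

text \<open>On the diagonal this extends the corresponding vector to all integers. Two arguments
  make it biadditive, so that a perturbed element can be expanded.\<close>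

definition corr :: "'a \<Rightarrow> 'a \<Rightarrow> int \<Rightarrow> bit"
  where "corr x y i = tr (x * frob i y)"

text \<open>Self-adjoint for the trace form, because the adjoint of \<open>frob 1\<close> is
  \<open>frob (-1)\<close>. Hence it acts on either argument of \<open>corr\<close> as the same
  operator \<open>Z\<close> on sequences.\<close>

definition zeta :: "'a \<Rightarrow> 'a"
  where "zeta x = frob 1 x + frob (-1) x"

lemma corr_add_left: "corr (x + y) z i = corr x z i + corr y z i"
  by (simp add: corr_def tr_add distrib_right)

lemma corr_add_right: "corr x (y + z) i = corr x y i + corr x z i"
  by (simp add: corr_def tr_add distrib_left frob_add)

lemma corr_frob_right: "corr x (frob j y) i = corr x y (i + j)"
  by (simp add: corr_def frob_frob)

lemma corr_frob_left: "corr (frob j x) y i = corr x y (i - j)"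
proof -
  have "frob j x * frob i y = frob j (x * frob (i - j) y)"
    by (simp add: frob_mult frob_frob)
  thus ?thesis by (simp add: corr_def)
qed

text \<open>Moving \<open>frob\<close> to the other factor changes the sign of the index, and the
  product is commutative. With \<open>corr_period\<close> this yields condition 2.\<close>

lemma corr_uminus: "corr x x (- i) = corr x x i"
  using corr_frob_left[of i x x 0] by (simp add: corr_def mult.commute)

lemma corr_period: "corr x y (i + int n) = corr x y i"
  by (simp add: corr_def frob_period)

lemma corr_zeta_funpow_right: "corr x ((zeta ^^ k) y) = (shift_sum 1 (-1) ^^ k) (corr x y)"
proof (induction k)
  case (Suc k)
  have "corr x (zeta z) = shift_sum 1 (-1) (corr x z)" for z
    by (simp add: fun_eq_iff shift_sum_def zeta_def corr_add_right corr_frob_right)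
  with Suc show ?case by simp
qed simp

lemma corr_zeta_funpow_left: "corr ((zeta ^^ k) x) y = (shift_sum 1 (-1) ^^ k) (corr x y)"
proof (induction k)
  case (Suc k)
  have "corr (zeta z) y = shift_sum 1 (-1) (corr z y)" for z
    by (simp add: fun_eq_iff shift_sum_def zeta_def corr_add_left corr_frob_left add.commute)
  with Suc show ?case by simp
qed simp

text \<open>The added element \<open>w + frob 1 w\<close> has trace 0. Among the mixed terms the
  unshifted ones cancel as \<open>corr x w = corr w x\<close>; in the quadratic term
  \<open>(1 + T) * (1 + T^(-1))\<close> equals \<open>T + T^(-1)\<close>. Either way one further
  factor \<open>Z\<close> arises.\<close>

lemma corr_perturb:
  fixes k :: nat and x :: 'a
  defines "w \<equiv> (zeta ^^ k) x"
  defines "y \<equiv> x + (w + frob 1 w)"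
  shows "tr y = tr x"
    and "corr y y i = corr x x i + ((shift_sum 1 (-1) ^^ Suc k) (corr x x) i
      + (shift_sum 1 (-1) ^^ (2 * k + 1)) (corr x x) i)"
proof -
  show "tr y = tr x" by (simp add: y_def tr_add)
  have xw: "corr x w = (shift_sum 1 (-1) ^^ k) (corr x x)"
    and wx: "corr w x = (shift_sum 1 (-1) ^^ k) (corr x x)"
    by (simp_all only: w_def corr_zeta_funpow_left corr_zeta_funpow_right)
  have ww: "corr w w = (shift_sum 1 (-1) ^^ (2 * k)) (corr x x)"
    by (simp only: w_def corr_zeta_funpow_left corr_zeta_funpow_right mult_2 funpow_add o_apply)
  have "corr y y i = corr x x i + ((corr x w (i + 1) + corr w x (i - 1))
      + (corr w w (i + 1) + corr w w (i - 1)))"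
    unfolding y_def corr_add_left corr_add_right corr_frob_left corr_frob_right xw wx
    by (simp add: add.commute add.left_commute)
  thus "corr y y i = corr x x i + ((shift_sum 1 (-1) ^^ Suc k) (corr x x) i
      + (shift_sum 1 (-1) ^^ (2 * k + 1)) (corr x x) i)"
    unfolding Suc_eq_plus1[symmetric] shift_sum_funpow_Suc xw wx ww by simp
qed


section \<open>Special values and sums of the extended corresponding vector\<close>

lemma add_left_self: "x + (x + y) = (y::'a)"
  by (simp flip: add.assoc)

text \<open>The square of \<open>x\<close> is a conjugate of \<open>x\<close>.\<close>

lemma corr_0: "corr x x 0 = tr x"
proof -
  have "x * x = frob 1 x"
    using frob_of_nat[of 1 x] by (simp add: power2_eq_square)
  thus ?thesis by (simp add: corr_def)
qed

text \<open>\<open>frob (int m)\<close> swaps the factors of \<open>x * frob (int m) x\<close>, so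
  the conjugates of this product repeat with period \<open>m\<close> and cancel in pairs.\<close>

lemma corr_half:
  assumes "n = m + m"
  shows "corr x x (int m) = 0"
proof -
  let ?g = "\<lambda>l. frob (int l) (x * frob (int m) x)"
  have "?g (l + m) = ?g l" for l
  proof -
    have "int (l + m) + int m = int l + int n"
      using assms by simp
    hence "frob (int (l + m) + int m) x = frob (int l) x"
      by (simp only: frob_period)
    thus ?thesis by (simp add: frob_mult frob_frob mult.commute)
  qed
  moreover have "(\<Sum>l<n. ?g l) = (\<Sum>l<m. ?g l) + (\<Sum>l<m. ?g (l + m))"
    using sum_lessThan_add[of ?g m m] by (simp only: assms[symmetric])
  ultimately have "trace2 n (x * frob (int m) x) = 0"
    by (simp add: trace2_eq_sum_frob)
  thus ?thesis by (simp add: corr_def tr_def)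
qed

text \<open>Let \<open>v\<close> be the trace of \<open>x\<close> to the field with 16 elements, with conjugates \<open>v 0, \<dots>, v 3\<close>. The
  trace of \<open>x\<close> to the field with 4 elements is \<open>t = v 0 + v 2\<close>, and the sum below is its norm
  \<open>t * t\<^sup>2\<close>, which is 1 because \<open>t + t\<^sup>2 = 1\<close>.\<close>

lemma sum_corr_1_mod_4:
  assumes n: "n = 4 * q" and "tr x = 1"
  shows "(\<Sum>j<q. corr x x (4 * int j + 1)) = 1"
proof -
  have int_n: "int n = 4 * int q" using n by simp
  define v where "v i = (\<Sum>j<q. frob (i + 4 * int j) x)" for i
  have v_period: "v (i + 4) = v i" for i
    using sum_periodic_shift[of "\<lambda>j. frob (i + 4 * j) x" q] frob_period[of i x] int_n
    by (simp add: v_def algebra_simps)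
  have v_periods: "v (4 * int j + i) = v i" for i j
    using v_period by (induction j) (simp_all add: algebra_simps, metis add.commute add.assoc)
  have frob_v: "frob i (v k) = v (i + k)" for i k
    by (simp add: v_def frob_sum frob_frob add.assoc)
  have v4: "v 4 = v 0" using v_period[of 0] by simp
  \<comment> \<open>Transitivity of the trace: summing first over each residue class modulo 4 turns
    the conjugates of \<open>x\<close> into those of \<open>v 0\<close>.\<close>
  have split: "(\<Sum>l<n. frob (int l) x * h (int l)) =
      v 0 * h 0 + v 1 * h 1 + v 2 * h 2 + v 3 * h 3"
    if "\<And>j i. h (4 * int j + i) = h i" for h
  proof -
    have h: "h (i + 4 * int j) = h i" "h (4 * int j) = h 0" for i j
      using that[of j i] that[of j 0] by (simp_all add: add.commute)
    have "(\<Sum>l<n. g l) = (\<Sum>j<q. g (4 * j) + g (4 * j + 1) + g (4 * j + 2) + g (4 * j + 3))"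
      for g :: "nat \<Rightarrow> 'a"
      using sum_lessThan_4_mult[of g q] by (simp only: n)
    thus ?thesis
      by (simp add: h v_def sum.distrib sum_distrib_right add.commute)
  qed
  define t where "t = v 0 + v 2"
  have t2: "t\<^sup>2 = v 1 + v 3"
    using frob_of_nat[of 1 t] by (simp add: t_def frob_add frob_v)
  have "t + t\<^sup>2 = trace2 n x"
    unfolding t2 using split[of "\<lambda>_. 1"] by (simp add: trace2_eq_sum_frob t_def ac_simps)
  also have "\<dots> = 1"
    using \<open>tr x = 1\<close> by (simp add: tr_eq_1_iff)
  finally have t: "t + t\<^sup>2 = 1" .
  hence "t\<^sup>2 = t + 1"
    by (metis add_left_self)
  \<comment> \<open>As \<open>v 1\<close> collects the conjugates with index 1 modulo 4, this trace
    is the required sum.\<close>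
  have "trace2 n (x * v 1) = (\<Sum>l<n. frob (int l) x * v (int l + 1))"
    by (simp add: trace2_eq_sum_frob frob_mult frob_v)
  also have "\<dots> = v 0 * v 1 + v 1 * v 2 + v 2 * v 3 + v 3 * v 0"
    using split[of "\<lambda>l. v (l + 1)"] v4 by (simp add: v_periods add.assoc)
  also have "\<dots> = t * t\<^sup>2"
    unfolding t2 by (simp add: t_def algebra_simps)
  also have "\<dots> = t * (t + 1)"
    using \<open>t\<^sup>2 = t + 1\<close> by simp
  also have "\<dots> = 1"
    using t by (simp add: distrib_left power2_eq_square add.commute)
  finally have "tr (x * v 1) = 1"
    by (simp add: tr_eq_1_iff)
  thus ?thesis
    by (simp add: v_def corr_def sum_distrib_left tr_sum add.commute)
qed

text \<open>Successive approximation with error \<open>?h \<alpha>\<close>: each stage lowers by one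
  the power of \<open>?Z\<close> that annihilates it, until at \<open>k = ?m\<close> the error
  itself is zero.\<close>

lemma ex_corr_eq:
  assumes n: "n = 2 ^ (r + 2)"
    and t_even: "\<And>i. t (- i) = t i" and t_period: "\<And>i. t (i + int n) = t i"
    and t: "t 0 = 1" "t (2 ^ (r + 1)) = 0" "(\<Sum>j<2 ^ r. t (4 * int j + 1)) = 1"
  shows "\<exists>\<alpha>. tr \<alpha> = 1 \<and> corr \<alpha> \<alpha> = t"
proof -
  let ?Z = "shift_sum 1 (-1)" and ?m = "2 ^ (r + 1) :: nat"
  let ?h = "\<lambda>\<alpha> i. corr \<alpha> \<alpha> i + t i"
  have n4: "n = 4 * 2 ^ r" and int_n: "int n = 2 ^ (r + 2)" using n by simp_all
  have even_periodic_corr: "even_periodic r (corr \<alpha> \<alpha>)" for \<alpha>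
    using corr_period[of \<alpha> \<alpha>] int_n by unfold_locales (simp_all add: corr_uminus)
  have even_periodic_h: "even_periodic r (?h \<alpha>)" for \<alpha>
    using corr_period[of \<alpha> \<alpha>] t_period int_n by unfold_locales (simp_all add: corr_uminus t_even)
  have m: "corr \<alpha> \<alpha> (2 ^ (r + 1)) = 0" for \<alpha>
    using corr_half[of ?m \<alpha>] n by simp
  \<comment> \<open>\<open>corr \<alpha> \<alpha>\<close> and \<open>t\<close> share these three
    quantities, so those of the error vanish; this starts the induction at
    \<open>k = 2\<close>.\<close>
  have h_0: "?h \<alpha> 0 = 0" and h_m: "?h \<alpha> (2 ^ (r + 1)) = 0"
    and h_sum: "(\<Sum>j<2 ^ r. ?h \<alpha> (4 * int j + 1)) = 0" if "tr \<alpha> = 1" for \<alpha>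
    using that sum_corr_1_mod_4[OF n4, of \<alpha>] m[of \<alpha>]
    by (simp_all only: corr_0 t sum.distrib bit_add_self)
  have "\<exists>\<alpha>. tr \<alpha> = 1 \<and> (?Z ^^ (?m - k)) (?h \<alpha>) = (\<lambda>i. 0)" if "2 \<le> k" "k \<le> ?m" for k
    using that
  proof (induction k rule: dec_induct)
    case base
    from ex_tr_eq_1 obtain \<alpha> where \<alpha>: "tr \<alpha> = 1" by blast
    interpret h: even_periodic r "?h \<alpha>" by (rule even_periodic_h)
    have "(?Z ^^ (?m - 2)) (?h \<alpha>) = (\<lambda>i. 0)"
      by (rule ext) (simp only: h.funpow_half_period_minus_2[OF h_0[OF \<alpha>] h_m[OF \<alpha>]] h_sum[OF \<alpha>] if_cancel)
    with \<alpha> show ?case by blast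
  next
    case (step k)
    then obtain \<alpha> where \<alpha>: "tr \<alpha> = 1" and zero: "(?Z ^^ (?m - k)) (?h \<alpha>) = (\<lambda>i. 0)"
      by auto
    interpret h: even_periodic r "?h \<alpha>" by (rule even_periodic_h)
    interpret f: even_periodic r "corr \<alpha> \<alpha>" by (rule even_periodic_corr)
    define d where "d = (?Z ^^ (?m - Suc k)) (?h \<alpha>)"
    have "?Z d = (?Z ^^ Suc (?m - Suc k)) (?h \<alpha>)"
      by (simp only: d_def funpow.simps o_apply)
    also have "Suc (?m - Suc k) = ?m - k"
      using step.prems by simp
    finally have parity: "d i = d (i mod 2)" for i
      unfolding zero by (rule shift_sum_zero_parity)
    have d0: "d 0 = 0"
    \<comment> \<open>In the last stage the exponent is 0 and evenness gives nothing; the error is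
      then known to vanish at 0 directly.\<close>
    proof (cases "?m - Suc k = 0")
      case False
      thus ?thesis unfolding d_def by (intro shift_sum_funpow_even_0 h.even) simp
    qed (simp only: d_def funpow_0 h_0[OF \<alpha>])
    show ?case
    proof (cases "d 1 = 0")
      case True
      have "d i = 0" for i
        using parity[of i] d0 True by (cases "odd i")
      (simp_all add: odd_iff_mod_2_eq_one even_iff_mod_2_eq_zero)
      hence "d = (\<lambda>i. 0)" by blast
      with \<alpha> show ?thesis unfolding d_def by blast
    next
      case False
      hence d1: "d 1 = 1" by simp
      \<comment> \<open>The exponent \<open>k - 1\<close> makes the two correction terms
        \<open>?Z ^^ k\<close> and \<open>?Z ^^ (2 * k - 1)\<close> of the current sequence.\<close>
      define w where "w = (zeta ^^ (k - 1)) \<alpha>"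
      define \<beta> where "\<beta> = \<alpha> + (w + frob 1 w)"
      have k: "Suc (k - 1) = k" "2 * (k - 1) + 1 = 2 * k - 1"
        using \<open>2 \<le> k\<close> by simp_all
      have "?h \<beta> = (\<lambda>i. ?h \<alpha> i + ((?Z ^^ k) (corr \<alpha> \<alpha>) i + (?Z ^^ (2 * k - 1)) (corr \<alpha> \<alpha>) i))"
        using corr_perturb(2)[where k = "k - 1" and x = \<alpha>] unfolding \<beta>_def w_def k
        by (simp only: ac_simps)
      hence "(?Z ^^ (?m - Suc k)) (?h \<beta>) i = d i
          + ((?Z ^^ (?m - Suc k)) ((?Z ^^ k) (corr \<alpha> \<alpha>)) i
           + (?Z ^^ (?m - Suc k)) ((?Z ^^ (2 * k - 1)) (corr \<alpha> \<alpha>)) i)" for i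
        by (simp only: shift_sum_funpow_add d_def)
      \<comment> \<open>The exponents add up to \<open>?m - 1\<close>, giving the indicator of the
        odd integers, which is also \<open>d\<close>; the two cancel.\<close>
      moreover have "(?Z ^^ (?m - Suc k)) ((?Z ^^ k) (corr \<alpha> \<alpha>)) i = of_bool (odd i)" for i
      proof -
        have "?m - Suc k + k = ?m - 1" using step.prems by simp
        hence "(?Z ^^ (?m - Suc k)) ((?Z ^^ k) (corr \<alpha> \<alpha>)) i = (?Z ^^ (?m - 1)) (corr \<alpha> \<alpha>) i"
          by (metis funpow_add o_apply)
        also have "\<dots> = of_bool (odd i)"
          unfolding f.funpow_half_period_minus_1 corr_0 m \<alpha> by simp
        finally show ?thesis .
      qed
      \<comment> \<open>Here the total exponent is \<open>?m + (k - 2)\<close>, which reaches the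
        vanishing power \<open>?m\<close> because \<open>k\<close> is at least 2.\<close>
      moreover have "(?Z ^^ (?m - Suc k)) ((?Z ^^ (2 * k - 1)) (corr \<alpha> \<alpha>)) i = 0" for i
      proof -
        have "?m - Suc k + (2 * k - 1) = (k - 2) + ?m" using step by simp
        hence "(?Z ^^ (?m - Suc k)) ((?Z ^^ (2 * k - 1)) (corr \<alpha> \<alpha>)) =
            (?Z ^^ (k - 2)) ((?Z ^^ ?m) (corr \<alpha> \<alpha>))"
          by (metis funpow_add o_apply)
        thus ?thesis
          unfolding f.funpow_half_period shift_sum_funpow_zero by simp
      qed
      moreover have "d i = of_bool (odd i)" for i
        using parity[of i] d0 d1 by (cases "odd i")
      (simp_all add: odd_iff_mod_2_eq_one even_iff_mod_2_eq_zero)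
      ultimately have "(?Z ^^ (?m - Suc k)) (?h \<beta>) = (\<lambda>i. 0)"
        by (simp add: fun_eq_iff)
      moreover have "tr \<beta> = 1"
        using \<alpha> unfolding \<beta>_def w_def corr_perturb(1) .
      ultimately show ?thesis by blast
    qed
  qed
  from this[of ?m] obtain \<alpha> where \<alpha>: "tr \<alpha> = 1" "?h \<alpha> = (\<lambda>i. 0)"
    using one_less_power[of "2::nat" "r + 1"] by auto
  have "corr \<alpha> \<alpha> i = t i" for i
    using fun_cong[OF \<alpha>(2), of i] by (cases "corr \<alpha> \<alpha> i"; cases "t i") simp_all
  with \<alpha>(1) show ?thesis by blast
qed

lemma corresponding_vector_iff:
  "corresponding_vector n \<alpha> a \<longleftrightarrow> (\<forall>i<n. a i = corr \<alpha> \<alpha> (int i))"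
proof -
  have "of_bit (a i) = trace2 n (\<alpha> * \<alpha> ^ (2 ^ i)) \<longleftrightarrow> a i = corr \<alpha> \<alpha> (int i)" for i
    by (simp only: of_bit_tr[symmetric] of_bit_inject corr_def frob_of_nat)
  thus ?thesis by (simp only: corresponding_vector_def)
qed

end

section \<open>Passing between vectors and even periodic sequences\<close>

theorem theorem3p5:
  fixes s n :: nat and a :: "nat \<Rightarrow> bit"
  assumes n_eq: "n = 2 ^ s" and n_ge: "n \<ge> 4"
    and card: "CARD('a::{field,finite}) = 2 ^ n"
  shows "(\<exists>\<alpha>::'a. normal_element n \<alpha> \<and> corresponding_vector n \<alpha> a) \<longleftrightarrow>
    (a 0 = 1 \<and> a (n div 2) = 0) \<and>
    (\<forall>i. 1 \<le> i \<and> i \<le> n div 2 - 1 \<longrightarrow> a i = a (n - i)) \<and>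
    (\<Sum>i | 1 \<le> i \<and> i \<le> n div 2 - 1 \<and> odd i. a i) = 1"
proof -
  interpret binary_field n "TYPE('a)" by unfold_locales (rule card)
  have "2 \<le> s"
    using n_ge n_eq power_increasing_iff[of "2::nat" 2 s] by simp
  hence "s = s - 2 + 2" by simp
  then obtain r where s: "s = r + 2" by blast
  define q :: nat where "q = 2 ^ r"
  have n: "n = 2 ^ (r + 2)" "n = 4 * q" "n div 2 = 2 * q"
    by (simp_all add: n_eq s q_def)
  have q: "q > 0" "int (2 * q) = 2 ^ (r + 1)" by (simp_all add: q_def)
  have odd_sum: "(\<Sum>i | 1 \<le> i \<and> i \<le> n div 2 - 1 \<and> odd i. a i) = (\<Sum>j<q. a (4 * j + 1))"
    if "\<forall>i. 1 \<le> i \<and> i \<le> n div 2 - 1 \<longrightarrow> a i = a (n - i)"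
    unfolding n(3) by (rule sum_odd_eq_sum_1_mod_4) (use that n in auto)
  show ?thesis
  proof
    assume "\<exists>\<alpha>::'a. normal_element n \<alpha> \<and> corresponding_vector n \<alpha> a"
    then obtain \<alpha> :: 'a where tr: "tr \<alpha> = 1" and a: "\<And>i. i < n \<Longrightarrow> a i = corr \<alpha> \<alpha> (int i)"
      using normal_element_iff_tr[OF n_eq] corresponding_vector_iff by blast
    have "a 0 = 1" using a[of 0] n_pos tr by (simp add: corr_0)
    moreover have "a (n div 2) = 0"
      using a[of "2 * q"] corr_half[of "2 * q" \<alpha>] n q by simp
    moreover have sym: "\<forall>i. 1 \<le> i \<and> i \<le> n div 2 - 1 \<longrightarrow> a i = a (n - i)"
    proof (intro allI impI)
      fix i assume i: "1 \<le> i \<and> i \<le> n div 2 - 1"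
      have "i \<le> n" using i n(3) by linarith
      hence "int (n - i) = - int i + int n" by (simp add: of_nat_diff)
      hence "corr \<alpha> \<alpha> (int (n - i)) = corr \<alpha> \<alpha> (int i)"
        by (simp only: corr_period corr_uminus)
      moreover have "i < n" "n - i < n" using i \<open>i \<le> n\<close> n(2,3) q(1) by linarith+
      ultimately show "a i = a (n - i)" by (simp only: a)
    qed
    moreover have "(\<Sum>j<q. a (4 * j + 1)) = (\<Sum>j<q. corr \<alpha> \<alpha> (4 * int j + 1))"
      by (intro sum.cong refl) (use a n in \<open>auto simp: add.commute\<close>)
    ultimately show "(a 0 = 1 \<and> a (n div 2) = 0) \<and>
        (\<forall>i. 1 \<le> i \<and> i \<le> n div 2 - 1 \<longrightarrow> a i = a (n - i)) \<and>
        (\<Sum>i | 1 \<le> i \<and> i \<le> n div 2 - 1 \<and> odd i. a i) = 1"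
      using sum_corr_1_mod_4[OF n(2) tr] odd_sum by simp
  next
    assume a: "(a 0 = 1 \<and> a (n div 2) = 0) \<and>
        (\<forall>i. 1 \<le> i \<and> i \<le> n div 2 - 1 \<longrightarrow> a i = a (n - i)) \<and>
        (\<Sum>i | 1 \<le> i \<and> i \<le> n div 2 - 1 \<and> odd i. a i) = 1"
    \<comment> \<open>The periodic extension to the integers, for which the three conditions become
      the hypotheses of \<open>ex_corr_eq\<close>.\<close>
    define t where "t i = a (nat (i mod int n))" for i
    have t_of_nat: "t (int i) = a i" if "i < n" for i
      using that by (simp add: t_def flip: zmod_int)
    \<comment> \<open>Condition 2 speaks of the lower half only; the upper half follows by
      reflection, and the midpoint is its own mirror image.\<close>
    have sym: "a (n - i) = a i" if "0 < i" "i < n" for i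
    proof -
      consider "i \<le> n div 2 - 1" | "i = n div 2" | "n - i \<le> n div 2 - 1"
        using that n by linarith
      thus ?thesis
      proof cases
        case 1
        thus ?thesis using a that by simp
      next
        case 2
        thus ?thesis using n by simp
      next
        case 3
        hence "a (n - i) = a (n - (n - i))" using a that by simp
        thus ?thesis using that by simp
      qed
    qed
    have "t (- i) = t i" for i
    \<comment> \<open>Multiples of \<open>n\<close> are treated apart, since reflecting the residue
      0 to \<open>n\<close> would leave the index range.\<close>
    proof (cases "i mod int n = 0")
      case False
      have "0 \<le> i mod int n" "i mod int n < int n" using n_pos by simp_all
      with False have "nat (i mod int n) > 0" "nat (i mod int n) < n"
        "nat ((- i) mod int n) = n - nat (i mod int n)"
        by (auto simp: zmod_zminus1_eq_if nat_diff_distrib)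
      with sym show ?thesis by (simp add: t_def)
    qed (simp add: t_def zmod_zminus1_eq_if)
    moreover have "t (i + int n) = t i" for i
      by (simp add: t_def)
    moreover have "t 0 = 1" "t (2 ^ (r + 1)) = 0"
      using t_of_nat[of 0] t_of_nat[of "2 * q"] a n q by simp_all
    moreover have "(\<Sum>j<2 ^ r. t (4 * int j + 1)) = 1"
    proof -
      have "(\<Sum>j<q. t (4 * int j + 1)) = (\<Sum>j<q. a (4 * j + 1))"
      proof (intro sum.cong refl)
        fix j assume "j \<in> {..<q}"
        thus "t (4 * int j + 1) = a (4 * j + 1)"
          using t_of_nat[of "4 * j + 1"] n by (simp add: add.commute)
      qed
      also have "\<dots> = 1"
        using odd_sum a by metis
      finally show ?thesis by (simp only: q_def)
    qed
    ultimately obtain \<alpha> :: 'a where "tr \<alpha> = 1" "corr \<alpha> \<alpha> = t"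
      using ex_corr_eq[OF n(1), of t] by blast
    hence "normal_element n \<alpha> \<and> corresponding_vector n \<alpha> a"
      using t_of_nat by (simp add: normal_element_iff_tr[OF n_eq] corresponding_vector_iff)
    thus "\<exists>\<alpha>::'a. normal_element n \<alpha> \<and> corresponding_vector n \<alpha> a" by blast
  qed
qed

end
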